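(* Let $x,z$ be formal variables and define rational functions $G_n(w)$ for $n\ge1$ by $G_1(w)=\frac1w$ and, for $n\ge2$, $$G_n(w)=\sum_{k=1}^{n-1}\frac{G_k(w)\,G_{n-k}(w+kz)}{w+(n-1)x}.$$ For integers $1\le k<n$ define $F_{k,n}(w)$ by $F_{1,n}(w)=G_n(w)$ and, for $k\ge2$, $$F_{k,n}(w)=\sum_{i=1}^{n-k-1}\frac{G_{n-k-i}(w+(k+i)z)\,F_{k,k+i}(w)}{w+(n-1)x}+\sum_{i=1}^{k-1}\frac{(w+iz)\,G_i(w+x)\,F_{k-i,n-i}(w+iz)}{w\,(w+(n-1)x)}.$$ Then for all integers $k,n$ with $1\le k\le n-2$, $$F_{k,n}(w)-F_{k+1,n}(w)=\frac{G_k(w+x)\,G_{n-k}(w+kz)}{w}.$$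
   Context: All functions are rational functions in $w,x,z$, with $x$ and $z$ treated as constant formal variables and $w$ as the argument. *)

theory Defs
  imports "HOL-Computational_Algebra.Polynomial" "HOL-Computational_Algebra.Fraction_Field"
begin

text \<open>
  Rational functions in \<open>w\<close> over the field \<open>K(x,z)\<close> of rational functions in the formal
  variables \<open>x\<close> and \<open>z\<close>. The ground field \<open>K\<close>, a type variable, is an arbitrary field of
  characteristic zero.
\<close>

type_synonym 'a coeff_field = "'a poly poly fract"
type_synonym 'a ratfun = "'a coeff_field poly fract"

definition x_var :: "'a::field_char_0 coeff_field" where
  "x_var = Fract [:[:0, 1:]:] 1"

definition z_var :: "'a::field_char_0 coeff_field" where
  "z_var = Fract [:0, 1:] 1"

definition const_fn :: "'b::field \<Rightarrow> 'b poly fract" where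
  "const_fn c = Fract [:c:] 1"

definition w_var :: "'b::field poly fract" where
  "w_var = Fract [:0, 1:] 1"

text \<open>
  The substitution \<open>w \<mapsto> w + c\<close>: \<open>shift c f\<close> is the rational function \<open>f(w + c)\<close>. Numerator and
  denominator are composed with the polynomial \<open>w + c\<close>; this respects equality of fractions.
\<close>

lift_definition shift :: "'b::field \<Rightarrow> 'b poly fract \<Rightarrow> 'b poly fract" is
  "\<lambda>c f. (pcompose (fst f) [:c, 1:], pcompose (snd f) [:c, 1:])"
proof -
  fix c :: 'b and f g :: "'b poly \<times> 'b poly"
  assume rel: "fractrel f g"
  have deg: "degree [:c, 1:] > 0"
    by simp
  have "pcompose (fst f * snd g) [:c, 1:] = pcompose (fst g * snd f) [:c, 1:]"
    using rel by (simp only: fractrel_def)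
  then show "fractrel (pcompose (fst f) [:c, 1:], pcompose (snd f) [:c, 1:])
      (pcompose (fst g) [:c, 1:], pcompose (snd g) [:c, 1:])"
    using rel by (simp only: fractrel_def fst_conv snd_conv pcompose_eq_0_iff[OF deg] pcompose_mult
        simp_thms)
qed

lemma shift_Fract:
  assumes "q \<noteq> 0"
  shows "shift c (Fract p q) = Fract (pcompose p [:c, 1:]) (pcompose q [:c, 1:])"
proof -
  have "degree [:c, 1:] > 0"
    by simp
  then have "pcompose q [:c, 1:] \<noteq> 0"
    using assms by (simp only: pcompose_eq_0_iff not_False_eq_True)
  then show ?thesis
    using assms
    by (simp add: Fract.abs_eq shift.abs_eq fractrel_def)
qed

text \<open>The value at index \<open>0\<close> is a dummy; the recursion only uses indices \<open>n \<ge> 1\<close>.\<close>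

function G_fun :: "nat \<Rightarrow> 'a::field_char_0 ratfun" where
  "G_fun n =
    (if n = 0 then 0
     else if n = 1 then 1 / w_var
     else (\<Sum>k = 1..n - 1. G_fun k * shift (of_nat k * z_var) (G_fun (n - k))
             / (w_var + const_fn (of_nat (n - 1) * x_var))))"
  by auto
termination by (relation "measure id") auto

declare G_fun.simps [simp del]

text \<open>
  \<open>F_fun k n\<close> is meaningful for \<open>1 \<le> k < n\<close> and a dummy otherwise; the recursion stays within
  this range.
\<close>

function F_fun :: "nat \<Rightarrow> nat \<Rightarrow> 'a::field_char_0 ratfun" where
  "F_fun k n =
    (if k = 0 \<or> n \<le> k then 0
     else if k = 1 then G_fun n
     else (\<Sum>i = 1..n - k - 1.
             shift (of_nat (k + i) * z_var) (G_fun (n - k - i)) * F_fun k (k + i)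
               / (w_var + const_fn (of_nat (n - 1) * x_var)))
        + (\<Sum>i = 1..k - 1.
             (w_var + const_fn (of_nat i * z_var)) * shift x_var (G_fun i)
                 * shift (of_nat i * z_var) (F_fun (k - i) (n - i))
               / (w_var * (w_var + const_fn (of_nat (n - 1) * x_var)))))"
  by auto
termination by (relation "measure snd") auto

declare F_fun.simps [simp del]

end

theory Submission
  imports Defs
begin

text \<open>
  Induction on \<open>n\<close>, extended to \<open>k = n - 1\<close>, where the second term on the left is the dummy value
  \<open>0\<close>. Multiply by \<open>w + (n - 1)x\<close>. In the difference of the two recursions the induction
  hypothesis turns the first sums into a sum of products \<open>G\<^sub>j(w + kz) G\<^sub>l(w + kz + jz)\<close> and the
  second sums into one of products \<open>G\<^sub>i(w + x) G\<^sub>j(w + x + iz)\<close>. The recursion of \<open>G\<close> evaluates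
  both as multiples of \<open>G\<^sub>k(w + x) G\<^sub>n\<^sub>-\<^sub>k(w + kz) / w\<close>, with factors \<open>w + kz + (n - k - 1)x\<close> and
  \<open>w + kx\<close>. The unpaired term \<open>i = k\<close> of the second sums contributes the factor \<open>- (w + kz)\<close>, so the
  factors add up to \<open>w + (n - 1)x\<close>.
\<close>

section \<open>The substitution as a field homomorphism\<close>

lemma shift_0 [simp]: "shift c 0 = 0"
  by (simp add: Zero_fract_def shift_Fract pcompose_1)

lemma shift_1 [simp]: "shift c 1 = 1"
  by (simp add: One_fract_def shift_Fract pcompose_1)

text \<open>Keeps denominators nonzero under the substitution, so that \<open>shift_Fract\<close>
  applies to sums, products and iterated shifts.\<close>

lemma pcompose_linear_eq_0_iff: "pcompose p [:c, 1::'b::field:] = 0 \<longleftrightarrow> p = 0"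
  by (rule pcompose_eq_0_iff) simp

lemma shift_add: "shift c (f + g) = shift c f + shift c g"
proof (cases f)
  case f: (Fract a b)
  show ?thesis
  proof (cases g)
    case (Fract d e)
    with f show ?thesis
      by (simp add: shift_Fract pcompose_linear_eq_0_iff pcompose_add pcompose_mult)
  qed
qed

lemma shift_mult: "shift c (f * g) = shift c f * shift c g"
proof (cases f)
  case f: (Fract a b)
  show ?thesis
  proof (cases g)
    case (Fract d e)
    with f show ?thesis
      by (simp add: shift_Fract pcompose_linear_eq_0_iff pcompose_mult)
  qed
qed

lemma shift_minus: "shift c (- f) = - shift c f"
  using shift_add[of c f "- f"] by (simp add: eq_neg_iff_add_eq_0 add.commute)

lemma shift_diff: "shift c (f - g) = shift c f - shift c g"
  using shift_add[of c f "- g"] by (simp add: shift_minus)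

lemma shift_inverse: "shift c (inverse f) = inverse (shift c f)"
proof (cases "f = 0")
  case False
  then have "shift c f * shift c (inverse f) = 1"
    by (simp flip: shift_mult)
  then show ?thesis
    by (simp add: inverse_unique)
qed simp

lemma shift_divide: "shift c (f / g) = shift c f / shift c g"
  by (simp add: divide_inverse shift_mult shift_inverse)

lemma shift_sum: "shift c (sum f A) = (\<Sum>i\<in>A. shift c (f i))"
  by (induction A rule: infinite_finite_induct) (simp_all add: shift_add)

lemma shift_shift: "shift c (shift d f) = shift (c + d) f"
proof (cases f)
  case (Fract a b)
  have "pcompose [:d, 1:] [:c, 1:] = [:c + d, 1:]"
    by (simp add: pcompose_pCons add.commute)
  then show ?thesis
    using Fract by (simp add: shift_Fract pcompose_linear_eq_0_iff flip: pcompose_assoc)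
qed

lemma const_fn_0 [simp]: "const_fn 0 = 0"
  by (simp add: const_fn_def Zero_fract_def)

lemma const_fn_add: "const_fn (a + b) = const_fn a + const_fn b"
  by (simp add: const_fn_def)

lemma shift_const_fn [simp]: "shift c (const_fn a) = const_fn a"
  by (simp add: const_fn_def shift_Fract pcompose_1)

lemma shift_w_var: "shift c w_var = w_var + const_fn c"
  by (simp add: const_fn_def w_var_def shift_Fract pcompose_pCons pcompose_1)

text \<open>Every denominator \<open>w + (n - 1)x\<close> and every factor \<open>w + iz\<close> has
  this form and can therefore be cancelled.\<close>

lemma w_var_add_const_fn_nonzero [simp]: "w_var + const_fn c \<noteq> 0"
  by (simp add: const_fn_def w_var_def Zero_fract_def eq_fract)

lemma w_var_nonzero [simp]: "w_var \<noteq> 0"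
  using w_var_add_const_fn_nonzero[of 0] by simp

section \<open>The recursions with cleared denominators\<close>

lemma G_fun_1: "G_fun (Suc 0) = 1 / w_var"
  by (simp add: G_fun.simps)

text \<open>At \<open>n = 1\<close> the sum is empty while \<open>w G_1(w) = 1\<close>; the
  correction term lets one formula cover all \<open>n\<close> from 1 on.\<close>

lemma G_fun_rec:
  assumes "1 \<le> n"
  shows "(w_var + const_fn (of_nat (n - 1) * x_var)) * (G_fun n :: 'a::field_char_0 ratfun)
    = (\<Sum>k = 1..n - 1. G_fun k * shift (of_nat k * z_var) (G_fun (n - k)))
        + (if n = 1 then 1 else 0)"
proof (cases "n = 1")
  case True
  then show ?thesis by (simp add: G_fun_1)
next
  case False
  with assms show ?thesis
    by (subst G_fun.simps) (simp flip: sum_divide_distrib)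
qed

lemma shift_G_fun_rec:
  assumes "1 \<le> n"
  shows "(w_var + const_fn (c + of_nat (n - 1) * x_var)) * shift c (G_fun n :: 'a::field_char_0 ratfun)
    = (\<Sum>k = 1..n - 1. shift c (G_fun k) * shift (c + of_nat k * z_var) (G_fun (n - k)))
        + (if n = 1 then 1 else 0)"
proof -
  have "(w_var + const_fn (c + of_nat (n - 1) * x_var)) * shift c (G_fun n)
    = shift c ((w_var + const_fn (of_nat (n - 1) * x_var)) * G_fun n)"
    by (simp add: shift_mult shift_add shift_w_var const_fn_add add.assoc)
  also have "\<dots> = (\<Sum>k = 1..n - 1. shift c (G_fun k) * shift (c + of_nat k * z_var) (G_fun (n - k)))
        + (if n = 1 then 1 else 0)"
    unfolding G_fun_rec[OF assms] by (simp add: shift_add shift_sum shift_mult shift_shift)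
  finally show ?thesis .
qed

text \<open>The second sum of the recursion after clearing \<open>w + (n - 1)x\<close>. The extra
  term at \<open>k = 1\<close> is \<open>G_1(w) G_{n-1}(w + z)\<close>, which gives
  \<open>F_{1,n} = G_n\<close> a recursion of the same shape as for larger \<open>k\<close>.\<close>

definition F_tail :: "nat \<Rightarrow> nat \<Rightarrow> 'a::field_char_0 ratfun" where
  "F_tail k n =
    (\<Sum>i = 1..k - 1. (w_var + const_fn (of_nat i * z_var)) / w_var * shift x_var (G_fun i)
        * shift (of_nat i * z_var) (F_fun (k - i) (n - i)))
      + (if k = 1 then shift z_var (G_fun (n - 1)) / w_var else 0)"

lemma F_fun_eq_0: "n \<le> k \<Longrightarrow> F_fun k n = 0"
  by (simp add: F_fun.simps)

text \<open>For \<open>k = 1\<close> the summand \<open>k = 1\<close> in the recursion of \<open>G_fun n\<close> moves into \<open>F_tail\<close>.\<close>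

lemma F_fun_rec:
  assumes "1 \<le> k" "k < n"
  shows "(w_var + const_fn (of_nat (n - 1) * x_var)) * (F_fun k n :: 'a::field_char_0 ratfun)
    = (\<Sum>m = k + 1..n - 1. shift (of_nat m * z_var) (G_fun (n - m)) * F_fun k m) + F_tail k n"
proof (cases "k = 1")
  case True
  have F1: "F_fun 1 m = (G_fun m :: 'a ratfun)" if "1 < m" for m
    using that by (simp add: F_fun.simps)
  have "(w_var + const_fn (of_nat (n - 1) * x_var)) * (G_fun n :: 'a ratfun)
      = (\<Sum>m = 1..n - 1. G_fun m * shift (of_nat m * z_var) (G_fun (n - m)))"
    using G_fun_rec[of n] assms True by simp
  also have "\<dots> = (\<Sum>m = 2..n - 1. G_fun m * shift (of_nat m * z_var) (G_fun (n - m)))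
      + shift z_var (G_fun (n - 1)) / w_var"
    using assms True by (subst sum.atLeast_Suc_atMost) (simp_all add: numeral_2_eq_2 G_fun_1)
  also have "(\<Sum>m = 2..n - 1. G_fun m * shift (of_nat m * z_var) (G_fun (n - m)))
      = (\<Sum>m = k + 1..n - 1. shift (of_nat m * z_var) (G_fun (n - m)) * (F_fun k m :: 'a ratfun))"
    using True F1 by (intro sum.cong) (auto simp: mult.commute)
  finally show ?thesis
    using True F1[of n] assms by (simp add: F_tail_def)
next
  case False
  let ?D = "w_var + const_fn (of_nat (n - 1) * x_var) :: 'a ratfun"
  have cancel: "d * (a / d + b / (w_var * d)) = a + b / w_var" if "d \<noteq> 0" for a b d :: "'a ratfun"
    using that by (simp add: field_simps)
  have "(F_fun k n :: 'a ratfun) = (\<Sum>i = 1..n - k - 1.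
          shift (of_nat (k + i) * z_var) (G_fun (n - k - i)) * F_fun k (k + i)) / ?D
      + (\<Sum>i = 1..k - 1. (w_var + const_fn (of_nat i * z_var)) * shift x_var (G_fun i)
          * shift (of_nat i * z_var) (F_fun (k - i) (n - i))) / (w_var * ?D)"
    using False assms by (subst F_fun.simps) (simp only: sum_divide_distrib, simp)
  then have "?D * F_fun k n = (\<Sum>i = 1..n - k - 1.
          shift (of_nat (k + i) * z_var) (G_fun (n - k - i)) * F_fun k (k + i))
      + (\<Sum>i = 1..k - 1. (w_var + const_fn (of_nat i * z_var)) * shift x_var (G_fun i)
          * shift (of_nat i * z_var) (F_fun (k - i) (n - i))) / w_var"
    by (simp only: cancel[OF w_var_add_const_fn_nonzero])
  also have "(\<Sum>i = 1..k - 1. (w_var + const_fn (of_nat i * z_var)) * shift x_var (G_fun i)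
          * shift (of_nat i * z_var) (F_fun (k - i) (n - i))) / w_var = (F_tail k n :: 'a ratfun)"
    using False by (simp add: F_tail_def sum_divide_distrib)
  also have "(\<Sum>i = 1..n - k - 1.
          shift (of_nat (k + i) * z_var) (G_fun (n - k - i)) * (F_fun k (k + i) :: 'a ratfun))
      = (\<Sum>m = k + 1..n - 1. shift (of_nat m * z_var) (G_fun (n - m)) * F_fun k m)"
    by (rule sum.reindex_bij_witness[of _ "\<lambda>m. m - k" "\<lambda>i. k + i"])
      (use assms in \<open>auto simp: algebra_simps\<close>)
  finally show ?thesis .
qed

section \<open>The induction\<close>

text \<open>The right-hand side of the claimed identity.\<close>

definition G_prod :: "nat \<Rightarrow> nat \<Rightarrow> 'a::field_char_0 ratfun" where
  "G_prod k n = shift x_var (G_fun k) * shift (of_nat k * z_var) (G_fun (n - k)) / w_var"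

text \<open>The subtracted sum is \<open>F_tail (k + 1) n\<close> without its term
  \<open>i = k\<close>. Paired termwise, the differences share a factor independent of
  \<open>i\<close>, and what remains is the convolution for \<open>G_k\<close> at
  \<open>w + x\<close>.\<close>

lemma F_tail_telescope:
  assumes "1 \<le> k" "k < n"
    and IH: "\<And>i. 1 \<le> i \<Longrightarrow> i < k \<Longrightarrow>
      (F_fun (k - i) (n - i) :: 'a::field_char_0 ratfun) - F_fun (k + 1 - i) (n - i) = G_prod (k - i) (n - i)"
  shows "(F_tail k n :: 'a ratfun) - (\<Sum>i = 1..k - 1. (w_var + const_fn (of_nat i * z_var)) / w_var
        * shift x_var (G_fun i) * shift (of_nat i * z_var) (F_fun (k + 1 - i) (n - i)))
    = (w_var + const_fn (of_nat k * x_var)) * G_prod k n"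
proof -
  let ?T = "\<lambda>i. (w_var + const_fn (of_nat i * z_var)) / w_var * shift x_var (G_fun i) :: 'a ratfun"
  let ?S = "\<lambda>i. shift (of_nat i * z_var) :: 'a ratfun \<Rightarrow> _"
  let ?g = "?S k (G_fun (n - k)) / w_var"
  have cancel: "d / w_var * a * (b * c / d) = a * b * (c / w_var)" if "d \<noteq> 0"
    for a b c d :: "'a ratfun"
    using that by (simp add: field_simps)
  have "?T i * ?S i (F_fun (k - i) (n - i)) - ?T i * ?S i (F_fun (k + 1 - i) (n - i))
      = shift x_var (G_fun i) * shift (x_var + of_nat i * z_var) (G_fun (k - i)) * ?g"
    if "i \<in> {1..k - 1}" for i
  proof -
    from that have i: "1 \<le> i" "i < k" by auto
    then have eq: "of_nat i * z_var + of_nat (k - i) * z_var = (of_nat k * z_var :: 'a coeff_field)"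
      by (simp flip: distrib_right of_nat_add)
    have "?T i * ?S i (F_fun (k - i) (n - i)) - ?T i * ?S i (F_fun (k + 1 - i) (n - i))
        = ?T i * ?S i (G_prod (k - i) (n - i))"
      unfolding IH[OF i, symmetric] by (simp only: right_diff_distrib shift_diff)
    \<comment> \<open>The shift by \<open>iz\<close> turns the \<open>1 / w\<close> of
      \<open>G_prod\<close> into \<open>1 / (w + iz)\<close>, which cancels the numerator
      \<open>w + iz\<close> of \<open>?T i\<close>. The shifts by \<open>iz\<close> and
      \<open>(k - i)z\<close> add up to \<open>kz\<close>.\<close>
    also have "?S i (G_prod (k - i) (n - i)) = shift (x_var + of_nat i * z_var) (G_fun (k - i))
        * ?S k (G_fun (n - k)) / (w_var + const_fn (of_nat i * z_var))"
      using i by (simp add: G_prod_def shift_divide shift_mult shift_shift shift_w_var eq add.commute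
          del: of_nat_diff)
    also have "?T i * \<dots> = shift x_var (G_fun i) * shift (x_var + of_nat i * z_var) (G_fun (k - i)) * ?g"
      by (rule cancel) simp
    finally show ?thesis .
  qed
  then have "(\<Sum>i = 1..k - 1. ?T i * ?S i (F_fun (k - i) (n - i)))
        - (\<Sum>i = 1..k - 1. ?T i * ?S i (F_fun (k + 1 - i) (n - i)))
      = (\<Sum>i = 1..k - 1. shift x_var (G_fun i)
          * shift (x_var + of_nat i * z_var) (G_fun (k - i))) * ?g"
    unfolding sum_distrib_right sum_subtractf[symmetric] by (rule sum.cong[OF refl])
  \<comment> \<open>The extra term of \<open>F_tail\<close> supplies the correction 1 in the
    recursion of \<open>G_k\<close> for \<open>k = 1\<close>.\<close>
  moreover have "(if k = 1 then shift z_var (G_fun (n - 1)) / w_var else 0)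
      = (if k = 1 then 1 else 0) * ?g"
    by simp
  ultimately have "F_tail k n - (\<Sum>i = 1..k - 1. ?T i * ?S i (F_fun (k + 1 - i) (n - i)))
      = ((\<Sum>i = 1..k - 1. shift x_var (G_fun i)
          * shift (x_var + of_nat i * z_var) (G_fun (k - i))) + (if k = 1 then 1 else 0)) * ?g"
    unfolding F_tail_def distrib_right diff_add_eq[symmetric] by (simp only:)
  also have "\<dots> = (w_var + const_fn (x_var + of_nat (k - 1) * x_var)) * shift x_var (G_fun k) * ?g"
    by (simp only: shift_G_fun_rec[OF \<open>1 \<le> k\<close>])
  also have "x_var + of_nat (k - 1) * x_var = (of_nat k * x_var :: 'a coeff_field)"
    using \<open>1 \<le> k\<close> by (cases k) (simp_all add: distrib_right)
  finally show ?thesis by (simp only: G_prod_def mult.assoc times_divide_eq_right)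
qed

text \<open>The range includes \<open>k = n - 1\<close> because the induction needs the pair
  \<open>(k, m)\<close> with \<open>m = k + 1\<close> in the first sums.\<close>

lemma F_fun_diff:
  assumes "1 \<le> k" "k < n"
  shows "(F_fun k n :: 'a::field_char_0 ratfun) - F_fun (k + 1) n = G_prod k n"
  using assms
proof (induction n arbitrary: k rule: less_induct)
  case (less n)
  note kn = \<open>1 \<le> k\<close> \<open>k < n\<close>
  let ?D = "w_var + const_fn (of_nat (n - 1) * x_var) :: 'a ratfun"
  let ?S = "\<lambda>i. shift (of_nat i * z_var) :: 'a ratfun \<Rightarrow> _"
  let ?R = "\<Sum>i = 1..k - 1. (w_var + const_fn (of_nat i * z_var)) / w_var * shift x_var (G_fun i)
      * ?S i (F_fun (k + 1 - i) (n - i))"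
  have tail: "F_tail k n - ?R = (w_var + const_fn (of_nat k * x_var)) * G_prod k n"
  proof (rule F_tail_telescope[OF kn])
    fix i assume "1 \<le> i" "i < k"
    then show "(F_fun (k - i) (n - i) :: 'a ratfun) - F_fun (k + 1 - i) (n - i) = G_prod (k - i) (n - i)"
      using less.IH[of "n - i" "k - i"] kn by (simp add: Suc_diff_le)
  qed
  have "?D * (F_fun k n - F_fun (k + 1) n) = ?D * G_prod k n"
  proof (cases "n = k + 1")
    case True
    \<comment> \<open>Here \<open>n - i = k + 1 - i\<close>, so every \<open>F_fun\<close> in
      \<open>?R\<close> has its default value 0. The first sum in the recursion of
      \<open>F_fun k n\<close> is empty, and \<open>tail\<close> already carries the factor
      \<open>w + (n - 1)x\<close>.\<close>
    then have "?R = 0"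
      by (intro sum.neutral) (simp add: F_fun_eq_0)
    with tail True have "F_tail k n = ?D * G_prod k n"
      by simp
    moreover from True have "?D * F_fun k n = F_tail k n"
      using F_fun_rec[OF kn] by simp
    moreover from True have "F_fun (k + 1) n = (0 :: 'a ratfun)"
      by (simp add: F_fun_eq_0)
    ultimately show ?thesis
      by (simp only: diff_zero)
  next
    case False
    with kn have n: "k + 2 \<le> n" by simp
    let ?A = "\<lambda>k m. ?S m (G_fun (n - m)) * F_fun k m"
    let ?h = "shift x_var (G_fun k) / w_var :: 'a ratfun"
    have step: "?A k m - ?A (k + 1) m
        = ?h * (?S k (G_fun (m - k)) * ?S m (G_fun (n - m)))" if "m \<in> {k + 1..n - 1}" for m
    proof -
      from that kn have "m < n" "k < m" by auto
      have "?A k m - ?A (k + 1) m = ?S m (G_fun (n - m)) * G_prod k m"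
        unfolding less.IH[OF \<open>m < n\<close> \<open>1 \<le> k\<close> \<open>k < m\<close>, symmetric] by (rule right_diff_distrib[symmetric])
      then show ?thesis by (simp add: G_prod_def)
    qed
    \<comment> \<open>The second sum may also start at \<open>m = k + 1\<close>, since
      \<open>F_fun (k + 1) (k + 1)\<close> is 0; the two sums then pair up.\<close>
    have "(\<Sum>m = k + 1..n - 1. ?A k m) - (\<Sum>m = k + 2..n - 1. ?A (k + 1) m)
        = (\<Sum>m = k + 1..n - 1. ?A k m) - (\<Sum>m = k + 1..n - 1. ?A (k + 1) m)"
      using n by (subst (3) sum.atLeast_Suc_atMost) (simp_all add: F_fun_eq_0)
    also have "\<dots> = ?h * (\<Sum>m = k + 1..n - 1. ?S k (G_fun (m - k)) * ?S m (G_fun (n - m)))"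
      unfolding sum_distrib_left sum_subtractf[symmetric] using step by (rule sum.cong[OF refl])
    also have "(\<Sum>m = k + 1..n - 1. ?S k (G_fun (m - k)) * ?S m (G_fun (n - m)))
        = (\<Sum>j = 1..n - k - 1. ?S k (G_fun j)
            * shift (of_nat k * z_var + of_nat j * z_var) (G_fun (n - k - j)))"
      by (rule sum.reindex_bij_witness[of _ "\<lambda>j. k + j" "\<lambda>m. m - k"])
        (use kn in \<open>auto simp flip: distrib_right of_nat_add\<close>)
    \<comment> \<open>As \<open>n - k\<close> is at least 2, the correction term of the recursion is
      absent.\<close>
    also have "\<dots> = (w_var + const_fn (of_nat k * z_var + of_nat (n - k - 1) * x_var))
        * ?S k (G_fun (n - k))"
      using shift_G_fun_rec[of "n - k" "of_nat k * z_var :: 'a coeff_field"] n by simp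
    finally have first: "(\<Sum>m = k + 1..n - 1. ?A k m) - (\<Sum>m = k + 2..n - 1. ?A (k + 1) m)
        = (w_var + const_fn (of_nat k * z_var + of_nat (n - k - 1) * x_var)) * G_prod k n"
      by (simp add: G_prod_def)
    \<comment> \<open>The term \<open>i = k\<close> of \<open>F_tail (k + 1) n\<close> has no
      partner in \<open>F_tail k n\<close>; it contains \<open>F_{1,n-k} = G_{n-k}\<close>.\<close>
    have "{1..k} = insert k {1..k - 1}"
      using kn by auto
    moreover have "F_fun (Suc 0) (n - k) = (G_fun (n - k) :: 'a ratfun)"
      using n by (subst F_fun.simps) simp
    ultimately have "F_tail (k + 1) n
        = ?R + (w_var + const_fn (of_nat k * z_var)) / w_var * shift x_var (G_fun k)
            * ?S k (G_fun (n - k))"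
      using kn by (simp add: F_tail_def add.commute)
    then have last: "F_tail (k + 1) n = ?R + (w_var + const_fn (of_nat k * z_var)) * G_prod k n"
      by (simp add: G_prod_def)
    \<comment> \<open>Used with \<open>p = kz\<close>, \<open>b = (n - k - 1)x\<close>,
      \<open>c = kx\<close> and \<open>h = G_prod k n\<close>: one \<open>w\<close> and
      \<open>p\<close> cancel, and \<open>b + c = (n - 1)x\<close>.\<close>
    have collect: "(w + (p + b)) * h + (t - (r + (w + p) * h)) = (w + (b + c)) * h"
      if "t - r = (w + c) * h" for b c h p r t w :: "'a ratfun"
      using that by (simp add: diff_eq_eq algebra_simps)
    have rec: "?D * F_fun (k + 1) n = (\<Sum>m = k + 2..n - 1. ?A (k + 1) m) + F_tail (k + 1) n"
      using F_fun_rec[of "k + 1" n] n by simp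
    have "?D * (F_fun k n - F_fun (k + 1) n)
        = ((\<Sum>m = k + 1..n - 1. ?A k m) - (\<Sum>m = k + 2..n - 1. ?A (k + 1) m))
            + (F_tail k n - F_tail (k + 1) n)"
      unfolding right_diff_distrib F_fun_rec[OF kn] rec by (rule add_diff_add)
    also have "\<dots> = (w_var + (const_fn (of_nat (n - k - 1) * x_var) + const_fn (of_nat k * x_var))) * G_prod k n"
      unfolding first last const_fn_add using tail by (rule collect)
    also have "const_fn (of_nat (n - k - 1) * x_var) + const_fn (of_nat k * x_var)
        = (const_fn (of_nat (n - 1) * x_var) :: 'a ratfun)"
      using n by (simp flip: const_fn_add distrib_right of_nat_add)
    finally show ?thesis .
  qed
  then show ?case by simp
qed

theorem theorem2p3:
  fixes k n :: nat
  assumes "1 \<le> k" and "k + 2 \<le> n"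
  shows "(F_fun k n :: 'a::field_char_0 ratfun) - F_fun (k + 1) n
    = shift x_var (G_fun k) * shift (of_nat k * z_var) (G_fun (n - k)) / w_var"
  using F_fun_diff[of k n] assms by (simp add: G_prod_def)

end
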